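(* Let $A$ be any $d\times n$ matrix over the finite field $k=\mathbb{F}_q$ with $q$ elements, where $q>d+1$. There is a vector $X\in k^n$ such that neither $X$ nor $AX$ has any zero entries if and only if no row of $A$ is identically $0$. *)

theory Defs
  imports "HOL-Library.Cardinality" "Jordan_Normal_Form.Matrix"
begin

end

(* Choose the entries of X one at a time. When x_j is chosen, every row i with a_ij nonzero
   forbids exactly one value, the one that makes its partial sum vanish; together with 0 this
   excludes at most d + 1 < q values. A row with a_ij = 0 keeps its partial sum. *)
theory Submission
  imports Defs
begin

text \<open>Induction on the number \<open>m\<close> of chosen entries. A row whose first
  \<open>m\<close> coefficients all vanish has partial sum 0 whatever \<open>x\<close> is, so the
  invariant constrains a row only from its first nonzero coefficient on.\<close>

lemma greedy_nonvanishing_sums: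
  fixes a :: "'i \<Rightarrow> nat \<Rightarrow> 'k :: {field, finite}"
  assumes "finite I" and card: "card I + 1 < CARD('k)"
  shows "\<exists>x. (\<forall>j<m. x j \<noteq> 0) \<and>
    (\<forall>i\<in>I. (\<exists>j<m. a i j \<noteq> 0) \<longrightarrow> (\<Sum>j<m. a i j * x j) \<noteq> 0)"
proof (induction m)
  case 0
  then show ?case by simp
next
  case (Suc m)
  then obtain x where x: "\<And>j. j < m \<Longrightarrow> x j \<noteq> 0"
    and sum_x: "\<And>i j. i \<in> I \<Longrightarrow> j < m \<Longrightarrow> a i j \<noteq> 0 \<Longrightarrow> (\<Sum>j<m. a i j * x j) \<noteq> 0"
    by blast
  \<comment> \<open>The image ranges over all of \<open>I\<close>, including rows with
    \<open>a i m = 0\<close>: division by zero yields 0 there, a value excluded anyway, so the bound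
    \<open>card I + 1\<close> is unaffected.\<close>
  define B where "B = insert 0 ((\<lambda>i. - (\<Sum>j<m. a i j * x j) / a i m) ` I)"
  have "card B \<le> Suc (card ((\<lambda>i. - (\<Sum>j<m. a i j * x j) / a i m) ` I))"
    unfolding B_def by (rule card_insert_le_m1) simp_all
  also have "\<dots> \<le> card I + 1"
    using card_image_le[OF \<open>finite I\<close>] by (metis Suc_eq_plus1 Suc_le_mono)
  finally have "card B \<le> card I + 1" .
  with card have "B \<noteq> UNIV" by auto
  then obtain y where "y \<notin> B" by blast
  define z where "z = x(m := y)"
  have sum_z: "(\<Sum>j<Suc m. a i j * z j) = (\<Sum>j<m. a i j * x j) + a i m * y" for i
    by (simp add: z_def)
  have "(\<Sum>j<Suc m. a i j * z j) \<noteq> 0" if "i \<in> I" "j < Suc m" "a i j \<noteq> 0" for i j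
  proof (cases "a i m = 0")
    case True
    \<comment> \<open>The nonzero coefficient lies before column \<open>m\<close>, so the induction
      hypothesis covers the unchanged sum.\<close>
    with that have "j < m" by (metis less_antisym)
    with that True sum_x show ?thesis unfolding sum_z by simp
  next
    case False
    \<comment> \<open>No induction hypothesis is needed here: avoiding this one value suffices
      whether or not the earlier partial sum vanishes.\<close>
    have "y \<noteq> - (\<Sum>j<m. a i j * x j) / a i m"
      using \<open>y \<notin> B\<close> \<open>i \<in> I\<close> by (auto simp: B_def)
    with False show ?thesis
      unfolding sum_z by (auto simp: field_simps eq_neg_iff_add_eq_0 add.commute)
  qed
  moreover have "z j \<noteq> 0" if "j < Suc m" for j
    using that x \<open>y \<notin> B\<close> by (auto simp: z_def B_def less_Suc_eq)
  ultimately show ?case by blast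
qed

theorem theorem25:
  fixes A :: "'k :: {field, finite} mat" and d n q :: nat
  assumes "A \<in> carrier_mat d n"
    and "CARD('k) = q"
    and "q > d + 1"
  shows "(\<exists>X \<in> carrier_vec n. (\<forall>j<n. X $ j \<noteq> 0) \<and> (\<forall>i<d. (A *\<^sub>v X) $ i \<noteq> 0))
    \<longleftrightarrow> (\<forall>i<d. row A i \<noteq> 0\<^sub>v n)"
proof
  assume "\<exists>X \<in> carrier_vec n. (\<forall>j<n. X $ j \<noteq> 0) \<and> (\<forall>i<d. (A *\<^sub>v X) $ i \<noteq> 0)"
  \<comment> \<open>A zero row \<open>i\<close> would make entry \<open>i\<close> of
    \<open>A *\<^sub>v X\<close> a scalar product with the zero vector, hence 0.\<close>
  with assms(1) show "\<forall>i<d. row A i \<noteq> 0\<^sub>v n" by fastforce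
next
  assume rows: "\<forall>i<d. row A i \<noteq> 0\<^sub>v n"
  obtain x where x: "\<forall>j<n. x j \<noteq> 0"
    and sum_x: "\<forall>i<d. (\<exists>j<n. A $$ (i, j) \<noteq> 0) \<longrightarrow> (\<Sum>j<n. A $$ (i, j) * x j) \<noteq> 0"
    \<comment> \<open>The index set is the set of all \<open>d\<close> rows, so the cardinality
      premise becomes \<open>d + 1 < q\<close>.\<close>
    using greedy_nonvanishing_sums[of "{..<d}" n "\<lambda>i j. A $$ (i, j)"] assms by auto
  have "(A *\<^sub>v vec n x) $ i \<noteq> 0" if "i < d" for i
  proof -
    have "\<exists>j<n. A $$ (i, j) \<noteq> 0"
    proof (rule ccontr)
      assume "\<not> (\<exists>j<n. A $$ (i, j) \<noteq> 0)"
      with assms(1) \<open>i < d\<close> have "row A i = 0\<^sub>v n" by (intro eq_vecI) auto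
      with rows \<open>i < d\<close> show False by blast
    qed
    moreover have "(A *\<^sub>v vec n x) $ i = (\<Sum>j<n. A $$ (i, j) * x j)"
      using assms(1) \<open>i < d\<close> by (simp add: scalar_prod_def lessThan_atLeast0)
    ultimately show ?thesis using sum_x \<open>i < d\<close> by simp
  qed
  with x show "\<exists>X \<in> carrier_vec n. (\<forall>j<n. X $ j \<noteq> 0) \<and> (\<forall>i<d. (A *\<^sub>v X) $ i \<noteq> 0)"
    by (intro bexI[of _ "vec n x"]) auto
qed

end
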